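(* Let $G=(V\cup\mathcal{H},D)$ be a factor analysis graph. Suppose that ZUTA is satisfied and let $\mathcal{A}=(A_h)_{h\in\mathcal{H}}$ be a valid collection that is ZUTA-compliant. Then $$\dim(F(G))\ge |V|+\sum_{h\in\mathcal{H}}|A_h|.$$
   Context: A factor analysis graph is a directed graph $G=(V\cup\mathcal{H},D)$ where $V$ (observed nodes) and $\mathcal{H}$ (latent nodes) are finite disjoint sets and $D\subseteq\mathcal{H}\times V$; an element $(h,v)\in D$ is an edge $h\to v$. Write $\mathrm{pa}(v)=\{h\in\mathcal{H}: (h,v)\in D\}$ for $v\in V$ and $\mathrm{ch}(h)=\{v\in V:(h,v)\in D\}$ for $h\in\mathcal{H}$. Let $p=|V|$ and $m=|\mathcal{H}|$. Let $\mathbb{R}^D$ be the set of real $|V|\times|\mathcal{H}|$ matrices $\Lambda=(\lambda_{vh})$ with $\lambda_{vh}=0$ whenever $(h,v)\notin D$, let $\mathbb{R}^p_{>0}$ be the set of diagonal $p\times p$ matrices with positive diagonal entries, and let $\mathrm{PD}(p)$ be the cone of positive definite symmetric $p\times p$ matrices. The factor analysis model $F(G)$ is the image of the map $\tau_G:\mathbb{R}^p_{>0}\times\mathbb{R}^D\to\mathrm{PD}(p)$, $(\Omega,\Lambda)\mapsto\Omega+\Lambda\Lambda^\top$. Its dimension $\dim(F(G))$ is the maximal rank of the Jacobian matrix of $\tau_G$ (as a map into the $\binom{p+1}{2}$-dimensional space of symmetric matrices). Let $C(V,2)$ be the set of all two-element subsets $\{u,v\}$ of $V$ (the $2$-pairs).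 For $h\in\mathcal{H}$ let $C(V,2)_h=\{\{u,v\}\in C(V,2): h\in\mathrm{pa}(u)\cap\mathrm{pa}(v)\}$. A collection $\mathcal{A}=(A_h)_{h\in\mathcal{H}}$ with $A_h\subseteq C(V,2)$ is valid if (i) $A_h\subseteq C(V,2)_h$ and $|A_h|\le|\mathrm{ch}(h)|$ for all $h\in\mathcal{H}$, and (ii) $A_h\cap A_\ell=\emptyset$ for all $h\neq\ell$. ZUTA (Zero Upper Triangular Assumption): there is a labeling $\mathcal{H}=\{h_1,\dots,h_m\}$ of the latent nodes such that $\mathrm{ch}(h_i)\not\subseteq\bigcup_{j>i}\mathrm{ch}(h_j)$ for all $i=1,\dots,m$. In this case there is a labeling $V=\{v_1,\dots,v_p\}$ of the observed nodes with $v_i\in\mathrm{ch}(h_i)$ and $v_i\notin\bigcup_{j>i}\mathrm{ch}(h_j)$ for all $i=1,\dots,m$. When ZUTA is satisfied, such labelings of $\mathcal{H}$ and $V$ are fixed, and a valid collection $\mathcal{A}$ is called ZUTA-compliant (with respect to these labelings) if $\{v_i,w\}\in A_{h_i}$ for all $w\in\mathrm{ch}(h_i)\setminus\{v_i\}$ and all $i\in\{1,\dots,m\}$. *)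

theory Defs
  imports "HOL-Analysis.Analysis" "HOL-Library.Function_Algebras"
begin

definition factor_analysis_graph :: "'a set \<Rightarrow> 'a set \<Rightarrow> ('a \<times> 'a) set \<Rightarrow> bool" where
  "factor_analysis_graph V H D \<longleftrightarrow> finite V \<and> finite H \<and> V \<inter> H = {} \<and> D \<subseteq> H \<times> V"

definition pa :: "('a \<times> 'a) set \<Rightarrow> 'a \<Rightarrow> 'a set" where
  "pa D v = {h. (h, v) \<in> D}"

definition ch :: "('a \<times> 'a) set \<Rightarrow> 'a \<Rightarrow> 'a set" where
  "ch D h = {v. (h, v) \<in> D}"


text \<open>Matrices with rows in a set R and columns in a set C are functions of two arguments; only
  their values on R and C matter. A column is regarded as a function that vanishes outside R, and
  functions form a real vector space under the pointwise operations.\<close>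

definition fun_scale :: "real \<Rightarrow> ('r \<Rightarrow> real) \<Rightarrow> 'r \<Rightarrow> real" where
  "fun_scale c f = (\<lambda>i. c * f i)"

lemma vector_space_fun_scale: "vector_space fun_scale"
  by unfold_locales (auto simp: fun_scale_def fun_eq_iff algebra_simps)

definition matrix_rank :: "'r set \<Rightarrow> 'c set \<Rightarrow> ('r \<Rightarrow> 'c \<Rightarrow> real) \<Rightarrow> nat" where
  "matrix_rank R C M = vector_space.dim fun_scale ((\<lambda>j i. if i \<in> R then M i j else 0) ` C)"

lemma matrix_rank_le_card:
  assumes "finite C"
  shows "matrix_rank R C M \<le> card C"
proof -
  interpret vector_space fun_scale by (rule vector_space_fun_scale)
  show ?thesis
    unfolding matrix_rank_def using assms
    by (meson card_image_le dim_le_card' finite_imageI order_trans)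
qed


text \<open>The diagonal matrix \<open>\<Omega>\<close> is given by its diagonal \<open>d\<close>.\<close>

definition diag_params :: "'a set \<Rightarrow> ('a \<Rightarrow> real) set" where
  "diag_params V = {d. (\<forall>v\<in>V. d v > 0) \<and> (\<forall>v. v \<notin> V \<longrightarrow> d v = 0)}"

definition loading_params :: "('a \<times> 'a) set \<Rightarrow> ('a \<Rightarrow> 'a \<Rightarrow> real) set" where
  "loading_params D = {\<Lambda>. \<forall>v h. (h, v) \<notin> D \<longrightarrow> \<Lambda> v h = 0}"

definition tau :: "'a set \<Rightarrow> ('a \<Rightarrow> real) \<Rightarrow> ('a \<Rightarrow> 'a \<Rightarrow> real) \<Rightarrow> 'a \<Rightarrow> 'a \<Rightarrow> real" where
  "tau H d \<Lambda> u w = (if u = w then d u else 0) + (\<Sum>h\<in>H. \<Lambda> u h * \<Lambda> w h)"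

text \<open>The coordinates on the space of symmetric matrices are the entries indexed by the unordered
  pairs \<open>{u, w}\<close>, where \<open>u = w\<close> is allowed.\<close>

definition sym_indices :: "'a set \<Rightarrow> 'a set set" where
  "sym_indices V = {{u, w} | u w. u \<in> V \<and> w \<in> V}"

definition sym_entry :: "('a \<Rightarrow> 'a \<Rightarrow> real) \<Rightarrow> 'a set \<Rightarrow> real" where
  "sym_entry S e = (THE s. \<exists>u w. e = {u, w} \<and> s = S u w)"

lemma sym_entry_eq:
  assumes "\<And>u w. S u w = S w u"
  shows "sym_entry S {u, w} = S u w"
  unfolding sym_entry_def using assms by (intro the_equality) (auto simp: doubleton_eq_iff)

lemma sym_entry_tau: "sym_entry (tau H d \<Lambda>) {u, w} = tau H d \<Lambda> u w"
  by (rule sym_entry_eq) (auto simp: tau_def mult.commute)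

text \<open>The Jacobian matrix has rows indexed by \<open>sym_indices V\<close> and columns by \<open>V <+> D\<close>:
  \<open>Inl v\<close> stands for the parameter \<open>d\<close> at \<open>v\<close>, and \<open>Inr (h, v)\<close> for \<open>\<Lambda>\<close> at row \<open>v\<close> and column
  \<open>h\<close>.\<close>

definition jacobian ::
  "'a set \<Rightarrow> ('a \<Rightarrow> real) \<Rightarrow> ('a \<Rightarrow> 'a \<Rightarrow> real) \<Rightarrow> 'a set \<Rightarrow> 'a + 'a \<times> 'a \<Rightarrow> real" where
  "jacobian H d \<Lambda> e c = (case c of
      Inl v \<Rightarrow> deriv (\<lambda>t. sym_entry (tau H (d(v := t)) \<Lambda>) e) (d v)
    | Inr (h, v) \<Rightarrow> deriv (\<lambda>t. sym_entry (tau H d (\<Lambda>(v := (\<Lambda> v)(h := t)))) e) (\<Lambda> v h))"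

definition dim_factor_model :: "'a set \<Rightarrow> 'a set \<Rightarrow> ('a \<times> 'a) set \<Rightarrow> nat" where
  "dim_factor_model V H D = Max {matrix_rank (sym_indices V) (V <+> D) (jacobian H d \<Lambda>) | d \<Lambda>.
     d \<in> diag_params V \<and> \<Lambda> \<in> loading_params D}"

lemma matrix_rank_le_dim_factor_model:
  assumes "factor_analysis_graph V H D" "d \<in> diag_params V" "\<Lambda> \<in> loading_params D"
  shows "matrix_rank (sym_indices V) (V <+> D) (jacobian H d \<Lambda>) \<le> dim_factor_model V H D"
proof -
  have "finite (V <+> D)"
    using assms(1) by (auto simp: factor_analysis_graph_def intro: finite_subset)
  then have "finite {matrix_rank (sym_indices V) (V <+> D) (jacobian H d \<Lambda>) | d \<Lambda>.
     d \<in> diag_params V \<and> \<Lambda> \<in> loading_params D}"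
    by (intro finite_subset[OF _ finite_atMost[of "card (V <+> D)"]])
       (auto intro: matrix_rank_le_card)
  then show ?thesis
    unfolding dim_factor_model_def using assms(2,3) by (intro Max_ge) auto
qed


definition pairs :: "'a set \<Rightarrow> 'a set set" where
  "pairs V = {e. e \<subseteq> V \<and> card e = 2}"

definition pairs_at :: "'a set \<Rightarrow> ('a \<times> 'a) set \<Rightarrow> 'a \<Rightarrow> 'a set set" where
  "pairs_at V D h = {{u, w} | u w. {u, w} \<in> pairs V \<and> h \<in> pa D u \<inter> pa D w}"

definition valid_collection ::
  "'a set \<Rightarrow> 'a set \<Rightarrow> ('a \<times> 'a) set \<Rightarrow> ('a \<Rightarrow> 'a set set) \<Rightarrow> bool" where
  "valid_collection V H D A \<longleftrightarrow>
     (\<forall>h\<in>H. A h \<subseteq> pairs_at V D h \<and> card (A h) \<le> card (ch D h)) \<and>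
     (\<forall>h\<in>H. \<forall>l\<in>H. h \<noteq> l \<longrightarrow> A h \<inter> A l = {})"

definition ZUTA_latent_labeling :: "'a set \<Rightarrow> ('a \<times> 'a) set \<Rightarrow> (nat \<Rightarrow> 'a) \<Rightarrow> bool" where
  "ZUTA_latent_labeling H D hl \<longleftrightarrow> bij_betw hl {1..card H} H \<and>
     (\<forall>i\<in>{1..card H}. \<not> ch D (hl i) \<subseteq> (\<Union>j\<in>{i<..card H}. ch D (hl j)))"

definition ZUTA :: "'a set \<Rightarrow> ('a \<times> 'a) set \<Rightarrow> bool" where
  "ZUTA H D \<longleftrightarrow> (\<exists>hl. ZUTA_latent_labeling H D hl)"

text \<open>The first \<open>card H\<close> observed labels are nodes that witness the latent labeling. These are
  pairwise distinct elements of V, so that \<open>card H \<le> card V\<close> holds automatically.\<close>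

definition ZUTA_observed_labeling ::
  "'a set \<Rightarrow> 'a set \<Rightarrow> ('a \<times> 'a) set \<Rightarrow> (nat \<Rightarrow> 'a) \<Rightarrow> (nat \<Rightarrow> 'a) \<Rightarrow> bool" where
  "ZUTA_observed_labeling V H D hl vl \<longleftrightarrow> bij_betw vl {1..card V} V \<and>
     (\<forall>i\<in>{1..card H}. vl i \<in> ch D (hl i) \<and> vl i \<notin> (\<Union>j\<in>{i<..card H}. ch D (hl j)))"

definition ZUTA_compliant ::
  "'a set \<Rightarrow> ('a \<times> 'a) set \<Rightarrow> (nat \<Rightarrow> 'a) \<Rightarrow> (nat \<Rightarrow> 'a) \<Rightarrow> ('a \<Rightarrow> 'a set set) \<Rightarrow> bool" where
  "ZUTA_compliant H D hl vl A \<longleftrightarrow>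
     (\<forall>i\<in>{1..card H}. \<forall>w\<in>ch D (hl i) - {vl i}. {vl i, w} \<in> A (hl i))"

end

theory Submission imports Defs begin

text \<open>Put \<open>\<Lambda> = 1\<close> at the edges \<open>h\<^sub>i \<rightarrow> v\<^sub>i\<close>. By compliance and \<open>|A\<^sub>h| \<le> |ch(h)|\<close>, each \<open>A\<^sub>h\<close> is a
  star centred at its \<open>v\<^sub>i\<close> plus at most one further pair \<open>{a, b}\<close>; put \<open>\<Lambda> = 1/4\<close> at the edges
  \<open>h \<rightarrow> a\<close> and \<open>h \<rightarrow> b\<close>, and \<open>\<Lambda> = 0\<close> elsewhere. The rows of the Jacobian at the diagonal entries and
  at the pairs in \<open>\<Union>A\<^sub>h\<close> are then linearly independent: the columns of \<open>\<Omega>\<close> remove the diagonal rows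
  from a linear relation, the columns of \<open>h\<close> at \<open>v\<^sub>i\<close>, \<open>a\<close> and \<open>b\<close> force the coefficient of \<open>{a, b}\<close> to
  vanish, and the other columns bound each coefficient of a star pair by half of the largest one.\<close>

section \<open>Linear algebra: independent rows and the dimension of the column space\<close>

lemma exists_nontrivial_solution:
  fixes R :: "'r set" and B :: "('r \<Rightarrow> real) set"
  assumes "finite R" "finite B" "card B < card R"
  shows "\<exists>c. (\<exists>e\<in>R. c e \<noteq> 0) \<and> (\<forall>b\<in>B. (\<Sum>e\<in>R. c e * b e) = 0)"
proof -
  interpret F: vector_space "fun_scale :: real \<Rightarrow> (('r \<Rightarrow> real) \<Rightarrow> real) \<Rightarrow> _"
    by (rule vector_space_fun_scale)
  \<comment> \<open>\<open>g e\<close> is evaluation at \<open>e\<close>, restricted to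
    \<open>B\<close>. A linear relation among the vectors \<open>g e\<close>,
    \<open>e \<in> R\<close>, is precisely a solution \<open>c\<close>.\<close>
  define g where "g e = (\<lambda>b. if b \<in> B then b e else 0)" for e
  define unit where "unit b = (\<lambda>b'. if b' = b then 1 else 0 :: real)" for b :: "'r \<Rightarrow> real"
  show ?thesis
  \<comment> \<open>Dependence of a set does not register repeated vectors, so a coincidence
    \<open>g x = g y\<close> is treated separately; it is solved by the indicator of
    \<open>x\<close> minus that of \<open>y\<close>.\<close>
  proof (cases "inj_on g R")
    case False
    then obtain x y where xy: "x \<in> R" "y \<in> R" "x \<noteq> y" "g x = g y"
      by (auto simp: inj_on_def)
    define c where "c e = (if e = x then 1 else 0) - (if e = y then 1 else 0 :: real)" for e
    have "(\<Sum>e\<in>R. c e * b e) = 0" if "b \<in> B" for b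
    proof -
      have "(\<Sum>e\<in>R. c e * b e) =
          (\<Sum>e\<in>R. if e = x then b e else 0) - (\<Sum>e\<in>R. if e = y then b e else 0)"
        unfolding sum_subtractf[symmetric] by (intro sum.cong) (auto simp: c_def)
      also have "\<dots> = b x - b y"
        using xy assms(1) by simp
      also have "\<dots> = 0"
        using fun_cong[OF xy(4), of b] that by (simp add: g_def)
      finally show ?thesis .
    qed
    moreover have "c x \<noteq> 0"
      using xy by (simp add: c_def)
    ultimately show ?thesis
      using xy by blast
  next
    case True
    have "g e \<in> F.span (unit ` B)" for e
    proof -
      have "g e = (\<Sum>b\<in>B. fun_scale (b e) (unit b))"
      proof
        fix b'
        have "(\<Sum>b\<in>B. fun_scale (b e) (unit b)) b' = (\<Sum>b\<in>B. fun_scale (b e) (unit b) b')"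
          using assms(2) by (induction rule: finite_induct) auto
        also have "\<dots> = (\<Sum>b\<in>B. if b' = b then b e else 0)"
          by (intro sum.cong) (auto simp: fun_scale_def unit_def)
        also have "\<dots> = g e b'"
          using assms(2) by (simp add: g_def)
        finally show "g e b' = (\<Sum>b\<in>B. fun_scale (b e) (unit b)) b'" ..
      qed
      then show ?thesis
        by (simp only:) (intro F.span_sum F.span_scale F.span_base imageI)
    qed
    then have sub: "g ` R \<subseteq> F.span (unit ` B)"
      by blast
    \<comment> \<open>\<open>card R\<close> distinct vectors lie in the span of at most
      \<open>card B\<close> unit vectors.\<close>
    have "F.dependent (g ` R)"
    proof (rule ccontr)
      assume "F.independent (g ` R)"
      from F.independent_span_bound[OF finite_imageI[OF assms(2)] this sub]
      have "card (g ` R) \<le> card B"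
        using card_image_le[OF assms(2), of unit] by linarith
      then show False
        using card_image[OF True] assms(3) by simp
    qed
    then obtain u where u: "\<exists>f\<in>g ` R. u f \<noteq> 0" "(\<Sum>f\<in>g ` R. fun_scale (u f) f) = 0"
      using F.dependent_finite[of "g ` R"] assms(1) by auto
    have "(\<Sum>e\<in>R. u (g e) * b e) = 0" if "b \<in> B" for b
    proof -
      have "(\<Sum>e\<in>R. u (g e) * b e) = (\<Sum>e\<in>R. fun_scale (u (g e)) (g e) b)"
        using that by (simp add: fun_scale_def g_def)
      also have "\<dots> = (\<Sum>e\<in>R. fun_scale (u (g e)) (g e)) b"
        using assms(1) by (induction rule: finite_induct) auto
      also have "\<dots> = 0"
        using u(2) sum.reindex[OF True, of "\<lambda>f. fun_scale (u f) f"] by simp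
      finally show ?thesis .
    qed
    with u(1) show ?thesis
      by (intro exI[of _ "\<lambda>e. u (g e)"]) auto
  qed
qed

text \<open>Row rank is at most column rank: if a basis of the column space had fewer than
  \<open>card R'\<close> elements, some nonzero \<open>c\<close> would annihilate the basis, hence
  every column, against \<open>indep\<close>.\<close>

lemma matrix_rank_ge_card_independent_rows:
  fixes M :: "'r \<Rightarrow> 'c \<Rightarrow> real"
  assumes "finite C" "finite R'" "R' \<subseteq> R"
    and indep: "\<And>c e. (\<And>j. j \<in> C \<Longrightarrow> (\<Sum>e\<in>R'. c e * M e j) = 0) \<Longrightarrow> e \<in> R' \<Longrightarrow> c e = 0"
  shows "card R' \<le> matrix_rank R C M"
proof (rule ccontr)
  interpret F: vector_space "fun_scale :: real \<Rightarrow> ('r \<Rightarrow> real) \<Rightarrow> _"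
    by (rule vector_space_fun_scale)
  let ?cols = "(\<lambda>j i. if i \<in> R then M i j else 0) ` C"
  assume less: "\<not> card R' \<le> matrix_rank R C M"
  obtain B where B: "B \<subseteq> ?cols" "F.independent B" "?cols \<subseteq> F.span B" "card B = F.dim ?cols"
    by (rule F.basis_exists)
  have "finite B"
    by (rule finite_subset[OF B(1)]) (simp add: assms(1))
  moreover have "card B < card R'"
    using less B(4) by (simp add: matrix_rank_def)
  ultimately obtain c where c: "\<exists>e\<in>R'. c e \<noteq> 0" "\<forall>b\<in>B. (\<Sum>e\<in>R'. c e * b e) = 0"
    using exists_nontrivial_solution[OF assms(2)] by blast
  have span: "(\<Sum>e\<in>R'. c e * x e) = 0" if "x \<in> F.span B" for x
    using that
  proof (induction rule: F.span_induct_alt)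
    case base
    show ?case by simp
  next
    case (step a x y)
    have "(\<Sum>e\<in>R'. c e * (fun_scale a x + y) e) =
        a * (\<Sum>e\<in>R'. c e * x e) + (\<Sum>e\<in>R'. c e * y e)"
      by (simp add: fun_scale_def algebra_simps sum.distrib sum_distrib_left)
    then show ?case
      using step c(2) by simp
  qed
  have "(\<Sum>e\<in>R'. c e * M e j) = 0" if "j \<in> C" for j
  proof -
    have "(\<Sum>e\<in>R'. c e * M e j) = (\<Sum>e\<in>R'. c e * (if e \<in> R then M e j else 0))"
      using assms(3) by (intro sum.cong) auto
    also have "\<dots> = 0"
      using B(3) that by (intro span) blast
    finally show ?thesis .
  qed
  with c(1) indep show False
    by blast
qed

section \<open>Derivatives of the parametrization\<close>

lemma jacobian_Inl: "jacobian H d \<Lambda> {u, w} (Inl v) = (if u = v \<and> w = v then 1 else 0)"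
proof -
  have "((\<lambda>t. tau H (d(v := t)) \<Lambda> u w) has_field_derivative (if u = v \<and> w = v then 1 else 0))
      (at (d v))"
    by (cases "u = w"; cases "u = v") (auto simp: tau_def intro!: derivative_eq_intros)
  then show ?thesis
    by (simp add: jacobian_def sym_entry_tau DERIV_imp_deriv)
qed

lemma jacobian_Inr:
  assumes "finite H" "h \<in> H"
  shows "jacobian H d \<Lambda> {u, w} (Inr (h, v)) =
    (if u = v then \<Lambda> w h else 0) + (if w = v then \<Lambda> u h else 0)"
proof -
  let ?L = "\<lambda>t. \<Lambda>(v := (\<Lambda> v)(h := t))"
  let ?D = "\<lambda>x k. if x = v \<and> k = h then 1 else 0 :: real"
  have L: "((\<lambda>t. ?L t x k) has_field_derivative ?D x k) (at (\<Lambda> v h))" for x k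
    by (cases "x = v"; cases "k = h") auto
  have same: "?L (\<Lambda> v h) x k = \<Lambda> x k" for x k
    by simp
  have "((\<lambda>t. tau H d (?L t) u w) has_field_derivative
      (\<Sum>k\<in>H. ?D u k * \<Lambda> w k + ?D w k * \<Lambda> u k)) (at (\<Lambda> v h))"
    unfolding tau_def
    using DERIV_add[OF DERIV_const DERIV_sum[OF DERIV_mult[OF L L]], unfolded same add_0_left] .
  moreover have "(\<Sum>k\<in>H. ?D u k * \<Lambda> w k + ?D w k * \<Lambda> u k) =
      (\<Sum>k\<in>H. if k = h then (if u = v then \<Lambda> w h else 0) + (if w = v then \<Lambda> u h else 0) else 0)"
    by (intro sum.cong) auto
  ultimately show ?thesis
    using assms by (simp add: jacobian_def sym_entry_tau DERIV_imp_deriv)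
qed

text \<open>Regard \<open>c\<close> as a symmetric matrix C supported on the pairs in
  \<open>E\<close>. Then the column of the edge from \<open>h\<close> to \<open>v\<close> yields the
  entry of C \<Lambda> at row \<open>v\<close> and column \<open>h\<close>: only pairs through
  \<open>v\<close> contribute, and each is \<open>{v, w}\<close> for one \<open>w\<close>.\<close>

lemma sum_jacobian_Inr:
  fixes c :: "'a set \<Rightarrow> real"
  assumes "finite H" "h \<in> H" "finite V" "E \<subseteq> pairs V"
  shows "(\<Sum>e\<in>E. c e * jacobian H d \<Lambda> e (Inr (h, v))) =
    (\<Sum>w\<in>V. (if {v, w} \<in> E then c {v, w} else 0) * \<Lambda> w h)"
proof -
  let ?W = "{w \<in> V. {v, w} \<in> E}"
  have fin: "finite E"
    using assms(3,4) by (auto simp: pairs_def intro: finite_subset[of _ "Pow V"])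
  have noloop: "{v, v} \<notin> E"
    using assms(4) by (auto simp: pairs_def)
  have other: "jacobian H d \<Lambda> e (Inr (h, v)) = 0" if e: "e \<in> E - (\<lambda>w. {v, w}) ` ?W" for e
  proof -
    obtain x y where xy: "e = {x, y}" "x \<in> V" "y \<in> V"
      using e assms(4) by (auto simp: pairs_def card_2_iff)
    with e have "x \<noteq> v" "y \<noteq> v"
      by (auto simp: insert_commute)
    with xy show ?thesis
      using assms(1,2) by (simp add: jacobian_Inr)
  qed
  have "(\<Sum>e\<in>E. c e * jacobian H d \<Lambda> e (Inr (h, v))) =
      (\<Sum>e\<in>(\<lambda>w. {v, w}) ` ?W. c e * jacobian H d \<Lambda> e (Inr (h, v)))"
    using fin other by (intro sum.mono_neutral_right) auto
  also have "\<dots> = (\<Sum>w\<in>?W. c {v, w} * jacobian H d \<Lambda> {v, w} (Inr (h, v)))"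
    by (subst sum.reindex) (auto simp: inj_on_def doubleton_eq_iff)
  \<comment> \<open>Since \<open>w\<close> differs from \<open>v\<close>, just one of the two
    summands in \<open>jacobian_Inr\<close> survives.\<close>
  also have "\<dots> = (\<Sum>w\<in>?W. c {v, w} * \<Lambda> w h)"
    using noloop assms(1,2) by (intro sum.cong) (auto simp: jacobian_Inr)
  also have "\<dots> = (\<Sum>w\<in>V. (if {v, w} \<in> E then c {v, w} else 0) * \<Lambda> w h)"
    using assms(3) by (intro sum.mono_neutral_cong_left) auto
  finally show ?thesis .
qed

section \<open>Collections containing a star of pairs at a chosen child of each latent node\<close>

locale star_collection =
  fixes V H :: "'a set" and D :: "('a \<times> 'a) set" and A :: "'a \<Rightarrow> 'a set set" and f :: "'a \<Rightarrow> 'a"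
  assumes graph: "factor_analysis_graph V H D"
    and valid: "valid_collection V H D A"
    and center: "h \<in> H \<Longrightarrow> f h \<in> ch D h"
    and star: "h \<in> H \<Longrightarrow> w \<in> ch D h - {f h} \<Longrightarrow> {f h, w} \<in> A h"
begin

lemma finite_V: "finite V" and finite_H: "finite H"
  using graph by (auto simp: factor_analysis_graph_def)

lemma ch_subset: "ch D h \<subseteq> V"
  using graph by (auto simp: factor_analysis_graph_def ch_def)

definition extra :: "'a \<Rightarrow> 'a set set" where
  "extra h = A h - (\<lambda>w. {f h, w}) ` (ch D h - {f h})"

lemma A_subset_pairs: "h \<in> H \<Longrightarrow> A h \<subseteq> pairs V"
  using valid by (fastforce simp: valid_collection_def pairs_at_def)

lemma pair_in_A:
  assumes "h \<in> H" "e \<in> A h"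
  obtains a b where "e = {a, b}" "a \<noteq> b" "a \<in> ch D h" "b \<in> ch D h"
proof -
  have "e \<in> pairs_at V D h"
    using valid assms by (auto simp: valid_collection_def)
  then show thesis
    by (auto simp: pairs_at_def pairs_def pa_def ch_def card_2_iff doubleton_eq_iff intro: that)
qed

lemma finite_A: "h \<in> H \<Longrightarrow> finite (A h)"
  using A_subset_pairs finite_V by (auto simp: pairs_def intro: finite_subset[of _ "Pow V"])

text \<open>The star already uses \<open>card (ch D h) - 1\<close> of the at most
  \<open>card (ch D h)\<close> pairs in \<open>A h\<close>, which leaves room for one more.\<close>

lemma extra_cases:
  assumes "h \<in> H"
  obtains (none) "extra h = {}"
    | (one) a b where "extra h = {{a, b}}" "a \<noteq> b" "a \<in> ch D h - {f h}" "b \<in> ch D h - {f h}"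
proof -
  let ?S = "(\<lambda>w. {f h, w}) ` (ch D h - {f h})"
  have "finite (ch D h)"
    using ch_subset finite_V finite_subset by blast
  moreover have "card ?S = card (ch D h - {f h})"
    by (intro card_image) (auto simp: inj_on_def doubleton_eq_iff)
  ultimately have "card ?S = card (ch D h) - 1"
    using center[OF assms] by simp
  moreover have "?S \<subseteq> A h"
    using star[OF assms] by auto
  ultimately have "card (extra h) = card (A h) - (card (ch D h) - 1)"
    using finite_A[OF assms] by (simp add: extra_def card_Diff_subset finite_subset)
  moreover have "card (A h) \<le> card (ch D h)"
    using valid assms by (auto simp: valid_collection_def)
  ultimately have "card (extra h) \<le> 1"
    by linarith
  moreover have "finite (extra h)"
    using finite_A[OF assms] by (simp add: extra_def)
  ultimately consider "extra h = {}" | e where "extra h = {e}"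
    by (metis card_0_eq card_1_singletonE le_antisym less_one not_le)
  then show thesis
  proof cases
    case 1
    then show thesis by (rule none)
  next
    case 2
    then have "e \<in> A h" and nS: "e \<notin> ?S"
      by (auto simp: extra_def)
    then obtain a b where ab: "e = {a, b}" "a \<noteq> b" "a \<in> ch D h" "b \<in> ch D h"
      using pair_in_A[OF assms] by blast
    \<comment> \<open>A pair of children of \<open>h\<close> through \<open>f h\<close> would belong
      to the star.\<close>
    moreover from ab nS have "a \<noteq> f h" "b \<noteq> f h"
      by (auto simp: insert_commute)
    ultimately show thesis
      using 2 one[of a b] by blast
  qed
qed

text \<open>Column \<open>h\<close> has at most two entries 1/4 besides the central 1. Their total
  1/2 stays strictly below 1, so the center dominates in every edge relation.\<close>

definition loading :: "'a \<Rightarrow> 'a \<Rightarrow> real" where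
  "loading w h = (if (h, w) \<notin> D then 0 else if w = f h then 1
     else if w \<in> \<Union>(extra h) then 1/4 else 0)"

lemma sum_loading:
  assumes "h \<in> H"
  shows "(\<Sum>w\<in>V. C w * loading w h) = C (f h) + (\<Sum>w\<in>\<Union>(extra h). C w) / 4"
proof -
  have sub: "\<Union>(extra h) \<subseteq> ch D h - {f h}"
    using extra_cases[OF assms] by (metis Union_empty ccpo_Sup_singleton empty_subsetI insert_subset)
  then have fin: "finite (\<Union>(extra h))"
    using ch_subset finite_V by (meson Diff_subset finite_subset)
  have "(\<Sum>w\<in>V. C w * loading w h) = (\<Sum>w\<in>insert (f h) (\<Union>(extra h)). C w * loading w h)"
    using sub center[OF assms] ch_subset[of h] finite_V
    by (intro sum.mono_neutral_right) (auto simp: loading_def)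
  also have "\<dots> = C (f h) * loading (f h) h + (\<Sum>w\<in>\<Union>(extra h). C w * loading w h)"
    using fin sub by (intro sum.insert) auto
  also have "(\<Sum>w\<in>\<Union>(extra h). C w * loading w h) = (\<Sum>w\<in>\<Union>(extra h). C w / 4)"
    using sub by (intro sum.cong) (auto simp: loading_def ch_def)
  also have "loading (f h) h = 1"
    using center[OF assms] by (simp add: loading_def ch_def)
  finally show ?thesis
    by (simp add: sum_divide_distrib)
qed

text \<open>The relations say that C \<Lambda> vanishes at every edge. It suffices to show that a
  coefficient of largest modulus is zero; extra pairs are settled by elimination, star pairs by
  dominance of the center.\<close>

lemma pair_relation_trivial:
  fixes c :: "'a set \<Rightarrow> real"
  defines "E \<equiv> \<Union>h\<in>H. A h"
  defines "C \<equiv> \<lambda>v w. if {v, w} \<in> E then c {v, w} else 0"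
  assumes rel: "\<And>h v. h \<in> H \<Longrightarrow> v \<in> ch D h \<Longrightarrow> C v (f h) + (\<Sum>w\<in>\<Union>(extra h). C v w) / 4 = 0"
    and "e \<in> E"
  shows "c e = 0"
proof -
  have C_sym: "C v w = C w v" for v w
    by (simp add: C_def insert_commute)
  have C_diag: "C v v = 0" for v
    using A_subset_pairs by (fastforce simp: C_def E_def pairs_def)
  have fin: "finite E"
    using finite_H finite_A by (auto simp: E_def)
  have "Max ((\<lambda>e. \<bar>c e\<bar>) ` E) \<in> (\<lambda>e. \<bar>c e\<bar>) ` E"
    using \<open>e \<in> E\<close> fin by (intro Max_in) auto
  then obtain m where "m \<in> E" "Max ((\<lambda>e. \<bar>c e\<bar>) ` E) = \<bar>c m\<bar>"
    by (rule imageE) simp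
  then have m: "m \<in> E" "\<And>e. e \<in> E \<Longrightarrow> \<bar>c e\<bar> \<le> \<bar>c m\<bar>"
    using fin by (metis Max_ge finite_imageI imageI)+
  then have C_le: "\<bar>C v w\<bar> \<le> \<bar>c m\<bar>" for v w
    by (simp add: C_def)
  from m(1) obtain h where h: "h \<in> H" "m \<in> A h"
    by (auto simp: E_def)
  have "c m = 0"
  proof (cases "m \<in> extra h")
    case True
    from h(1) show ?thesis
    proof (cases rule: extra_cases)
      case none
      with True show ?thesis by simp
    next
      case (one a b)
      with True have "m = {a, b}" by simp
      \<comment> \<open>These are the relations at \<open>a\<close>, \<open>b\<close> and
        \<open>f h\<close>, simplified by the zero diagonal and symmetry of \<open>C\<close>. The
        first two minus the third leave \<open>C a b / 2 = 0\<close>.\<close>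
      have "C a (f h) + C a b / 4 = 0" "C b (f h) + C a b / 4 = 0" "C a (f h) + C b (f h) = 0"
        using rel[OF h(1), of a] rel[OF h(1), of b] rel[OF h(1) center[OF h(1)]] one
          C_sym[of a b] C_sym[of a "f h"] C_sym[of b "f h"]
        by (simp_all add: C_diag)
      then have "C a b = 0"
        by linarith
      then show ?thesis
        using m(1) \<open>m = {a, b}\<close> by (simp add: C_def)
    qed
  next
    case False
    with h obtain w where w: "w \<in> ch D h" "m = {f h, w}"
      by (auto simp: extra_def)
    \<comment> \<open>There are at most two terms, each bounded by maximality of \<open>m\<close>,
      whichever \<open>A l\<close> its pair belongs to. The relation at \<open>w\<close> then gives
      \<open>\<bar>c m\<bar> \<le> \<bar>c m\<bar> / 2\<close>.\<close>
    have "\<bar>\<Sum>x\<in>\<Union>(extra h). C w x\<bar> \<le> 2 * \<bar>c m\<bar>"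
      using h(1)
    proof (cases rule: extra_cases)
      case none
      then show ?thesis by simp
    next
      case (one a b)
      then show ?thesis
        using C_le[of w a] C_le[of w b] by simp
    qed
    moreover have "C w (f h) = c m"
      using m(1) w(2) by (simp add: C_def insert_commute)
    ultimately show ?thesis
      using rel[OF h(1) w(1)] by linarith
  qed
  then show ?thesis
    using m(2)[OF \<open>e \<in> E\<close>] by simp
qed

section \<open>The rank bound at the chosen parameter point\<close>

lemma dim_factor_model_ge: "card V + (\<Sum>h\<in>H. card (A h)) \<le> dim_factor_model V H D"
proof -
  define E where "E = (\<Union>h\<in>H. A h)"
  \<comment> \<open>Diagonal entries are indexed by singletons, because
    \<open>{v, v} = {v}\<close>.\<close>
  define S where "S = (\<lambda>v. {v}) ` V"
  \<comment> \<open>The derivative formulas do not involve \<open>d\<close>, so any admissible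
    diagonal serves.\<close>
  define d where "d = (\<lambda>v. if v \<in> V then 1 else 0 :: real)"
  let ?J = "jacobian H d loading"
  have E_pairs: "E \<subseteq> pairs V"
    using A_subset_pairs by (auto simp: E_def)
  have fin: "finite E" "finite S"
    using finite_H finite_A finite_V by (auto simp: E_def S_def)
  have disj: "S \<inter> E = {}"
    using E_pairs by (auto simp: S_def pairs_def)
  have "card E = (\<Sum>h\<in>H. card (A h))"
    unfolding E_def using finite_H finite_A valid
    by (intro card_UN_disjoint) (auto simp: valid_collection_def)
  moreover have "card S = card V"
    unfolding S_def by (intro card_image) auto
  ultimately have card: "card (S \<union> E) = card V + (\<Sum>h\<in>H. card (A h))"
    using fin disj by (simp add: card_Un_disjoint)
  have sub: "S \<union> E \<subseteq> sym_indices V"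
  proof
    fix e assume "e \<in> S \<union> E"
    then obtain x y where "e = {x, y}" "e \<subseteq> V"
      using E_pairs by (auto simp: S_def pairs_def card_2_iff)
    then show "e \<in> sym_indices V"
      by (auto simp: sym_indices_def)
  qed
  have "finite D"
    using graph by (auto simp: factor_analysis_graph_def intro: finite_subset)
  have "card (S \<union> E) \<le> matrix_rank (sym_indices V) (V <+> D) ?J"
  proof (rule matrix_rank_ge_card_independent_rows)
    show "finite (V <+> D)" "finite (S \<union> E)"
      using finite_V \<open>finite D\<close> fin by auto
    show "S \<union> E \<subseteq> sym_indices V"
      by (rule sub)
  next
    fix c e
    assume rel: "\<And>j. j \<in> V <+> D \<Longrightarrow> (\<Sum>e\<in>S \<union> E. c e * ?J e j) = 0" and e: "e \<in> S \<union> E"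
    \<comment> \<open>The column of the parameter \<open>d v\<close> is the unit vector at row
      \<open>{v}\<close>.\<close>
    have cS: "c {v} = 0" if "v \<in> V" for v
    proof -
      have Jv: "?J e (Inl v) = (if e = {v} then 1 else 0)" if "e \<in> S \<union> E" for e
      proof -
        obtain x y where "e = {x, y}"
          using subsetD[OF sub \<open>e \<in> S \<union> E\<close>] by (auto simp: sym_indices_def)
        then show ?thesis
          by (auto simp: jacobian_Inl)
      qed
      have "0 = (\<Sum>e\<in>S \<union> E. c e * ?J e (Inl v))"
        using rel[of "Inl v"] that by auto
      also have "\<dots> = (\<Sum>e\<in>S \<union> E. if e = {v} then c e else 0)"
        by (intro sum.cong) (auto simp: Jv)
      also have "\<dots> = c {v}"
        using fin that by (simp add: S_def)
      finally show ?thesis by simp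
    qed
    have "c e = 0" if "e \<in> E"
    proof (rule pair_relation_trivial)
      show "e \<in> (\<Union>h\<in>H. A h)"
        using that by (simp add: E_def)
    next
      fix h v assume hv: "h \<in> H" "v \<in> ch D h"
      have "0 = (\<Sum>e\<in>S \<union> E. c e * ?J e (Inr (h, v)))"
        using rel[of "Inr (h, v)"] hv by (auto simp: ch_def)
      \<comment> \<open>The diagonal rows drop out because their coefficients are already known to
        vanish.\<close>
      also have "\<dots> = (\<Sum>e\<in>E. c e * ?J e (Inr (h, v)))"
        using fin cS by (intro sum.mono_neutral_right) (auto simp: S_def)
      also have "\<dots> = (\<Sum>w\<in>V. (if {v, w} \<in> E then c {v, w} else 0) * loading w h)"
        using finite_H hv(1) finite_V E_pairs by (rule sum_jacobian_Inr)
      also have "\<dots> = (if {v, f h} \<in> E then c {v, f h} else 0) +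
          (\<Sum>w\<in>\<Union>(extra h). if {v, w} \<in> E then c {v, w} else 0) / 4"
        by (rule sum_loading[OF hv(1)])
      finally show "(if {v, f h} \<in> (\<Union>h\<in>H. A h) then c {v, f h} else 0) +
          (\<Sum>w\<in>\<Union>(extra h). if {v, w} \<in> (\<Union>h\<in>H. A h) then c {v, w} else 0) / 4 = 0"
        by (simp add: E_def)
    qed
    with e cS show "c e = 0"
      by (auto simp: S_def)
  qed
  also have "\<dots> \<le> dim_factor_model V H D"
    using graph by (intro matrix_rank_le_dim_factor_model)
      (auto simp: d_def diag_params_def loading_params_def loading_def)
  finally show ?thesis
    by (simp add: card)
qed

end

theorem theorem2p12:
  fixes V H :: "'a set" and D :: "('a \<times> 'a) set"
    and hl vl :: "nat \<Rightarrow> 'a" and A :: "'a \<Rightarrow> 'a set set"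
  assumes "factor_analysis_graph V H D"
    and "ZUTA H D"
    and "ZUTA_latent_labeling H D hl"
    and "ZUTA_observed_labeling V H D hl vl"
    and "valid_collection V H D A"
    and "ZUTA_compliant H D hl vl A"
  shows "dim_factor_model V H D \<ge> card V + (\<Sum>h\<in>H. card (A h))"
proof -
  \<comment> \<open>Inverting the latent labeling turns the witness \<open>vl i\<close> of
    \<open>hl i\<close> into a center depending on the latent node itself.\<close>
  define idx where "idx = the_inv_into {1..card H} hl"
  have bij: "bij_betw hl {1..card H} H"
    using assms(3) by (simp add: ZUTA_latent_labeling_def)
  have idx: "idx h \<in> {1..card H}" "hl (idx h) = h" if "h \<in> H" for h
    using that bij f_the_inv_into_f_bij_betw[OF bij] bij_betwE[OF bij_betw_the_inv_into[OF bij]]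
    by (auto simp: idx_def)
  have "star_collection V H D A (\<lambda>h. vl (idx h))"
  proof
    fix h assume "h \<in> H"
    then show "vl (idx h) \<in> ch D h"
      using idx[of h] assms(4) unfolding ZUTA_observed_labeling_def by metis
  next
    fix h w assume "h \<in> H" "w \<in> ch D h - {vl (idx h)}"
    then show "{vl (idx h), w} \<in> A h"
      using idx[of h] assms(6) unfolding ZUTA_compliant_def by metis
  qed (use assms in auto)
  then show ?thesis
    by (rule star_collection.dim_factor_model_ge)
qed

end
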